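(* Let $\mathcal{T}=(\mathcal{V},\mathcal{E})$ be a tree with $d$ vertices, $\lambda>0$, $\boldsymbol{\alpha}\in(0,1)^{d-1}$, $\boldsymbol{N}=(N_j,\,j\in\mathcal{V})\sim\mathrm{MPMRF}(\lambda,\boldsymbol{\alpha},\mathcal{T})$ and $M=\sum_{j\in\mathcal{V}}N_j$. Let $v,w\in\mathcal{V}$. If $N_v$ is less contributing than $N_w$ to $M$, i.e. $(N_v,M)\preceq_{sm}(N_w,M)$, then: (a) $\mathrm{Cov}(N_v,M)\le\mathrm{Cov}(N_w,M)$; (b) $\mathrm{E}[N_v\mathbb{1}_{\{M\le k\}}]\ge\mathrm{E}[N_w\mathbb{1}_{\{M\le k\}}]$ for all $k\in\mathbb{N}$; (c) $\mathcal{C}^{\mathrm{TVaR}}_\kappa(N_v;M)\le\mathcal{C}^{\mathrm{TVaR}}_\kappa(N_w;M)$ for all $\kappa\in[0,1)$.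
   Context: Trees and rootings. A tree $\mathcal{T}=(\mathcal{V},\mathcal{E})$ is a finite simple undirected graph in which any two vertices are joined by exactly one path. For a chosen root $r\in\mathcal{V}$ and $v\neq r$, $\mathrm{pa}(v)$ is the neighbour of $v$ on its path to $r$. The family MPMRF. For a count random variable $N$ and $\alpha\in[0,1]$, binomial thinning is $\alpha\circ N=\sum_{i=1}^{N}I_i^{(\alpha)}$ with $(I_i^{(\alpha)})_i$ i.i.d. Bernoulli($\alpha$), independent of $N$ (the empty sum is $0$); thinnings attached to different edges use independent Bernoulli variables. Given a tree $\mathcal{T}$, $\lambda>0$ and $\boldsymbol{\alpha}=(\alpha_e,e\in\mathcal{E})$, choose a root $r$ and let $(L_v,v\in\mathcal{V})$ be independent (and independent of all thinning variables) with $L_r\sim\mathrm{Poisson}(\lambda)$ and $L_v\sim\mathrm{Poisson}(\lambda(1-\alpha_{(\mathrm{pa}(v),v)}))$ for $v\neq r$. Set $N_r=L_r$ and $N_v=L_v+\alpha_{(\mathrm{pa}(v),v)}\circ N_{\mathrm{pa}(v)}$ for $v\ne r$, recursively down the tree. The law of $\boldsymbol{N}=(N_v,v\in\mathcal{V})$ does not depend on the chosen root; one writes $\boldsymbol{N}\sim\mathrm{MPMRF}(\lambda,\boldsymbol{\alpha},\mathcal{T})$. All marginals are $\mathrm{Poisson}(\lambda)$. Supermodular order. $\boldsymbol{X}\preceq_{sm}\boldsymbol{X}'$ means $\mathrm{E}[\zeta(\boldsymbol{X})]\le\mathrm{E}[\zeta(\boldsymbol{X}')]$ for every supermodular $\zeta$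 (i.e. $\zeta(\boldsymbol{x})+\zeta(\boldsymbol{x}')\le\zeta(\boldsymbol{x}\wedge\boldsymbol{x}')+\zeta(\boldsymbol{x}\vee\boldsymbol{x}')$ for all $\boldsymbol{x},\boldsymbol{x}'$, with componentwise minimum and maximum) for which the expectations exist. TVaR contribution. For a random variable $M$ with values in $\mathbb{N}=\{0,1,2,\dots\}$, with cdf $F_M$ and pmf $p_M$, let $\mathrm{VaR}_\kappa(M)=\inf\{x\in\mathbb{N}:F_M(x)\ge\kappa\}$ for $\kappa\in[0,1)$. The contribution of $N_v$ to the Tail-Value-at-Risk of $M$ under Euler's principle is $$\mathcal{C}^{\mathrm{TVaR}}_\kappa(N_v;M)=\frac{1}{1-\kappa}\left(\mathrm{E}[N_v\mathbb{1}_{\{M>\mathrm{VaR}_\kappa(M)\}}]+\frac{F_M(\mathrm{VaR}_\kappa(M))-\kappa}{p_M(\mathrm{VaR}_\kappa(M))}\,\mathrm{E}[N_v\mathbb{1}_{\{M=\mathrm{VaR}_\kappa(M)\}}]\right).$$ *)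

theory Defs
  imports "HOL-Probability.Probability" "Graph_Theory.Pair_Digraph"
begin

section \<open>Trees and rootings\<close>

text \<open>
  The locale \<open>pair_graph\<close> describes finite simple undirected graphs, each undirected edge being
  represented by its two opposite arcs. The library constant \<open>tree\<close> is not applicable to this
  representation (an arc followed by its opposite counts as a cycle there).
\<close>

locale pair_tree = pair_graph +
  assumes unique_path: "u \<in> pverts G \<Longrightarrow> v \<in> pverts G \<Longrightarrow> \<exists>!p. apath u p v"

definition uedges :: "'a pair_pre_digraph \<Rightarrow> 'a set set" where
  "uedges G = (\<lambda>(u, w). {u, w}) ` parcs G"

definition root_path :: "'a pair_pre_digraph \<Rightarrow> 'a \<Rightarrow> 'a \<Rightarrow> ('a \<times> 'a) list" where
  "root_path G r v = (THE p. pre_digraph.apath (with_proj G) v p r)"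

text \<open>The path from \<open>v\<close> to the root \<open>r\<close> starts with the arc from \<open>v\<close> to \<open>parent G r v\<close>.\<close>

definition parent :: "'a pair_pre_digraph \<Rightarrow> 'a \<Rightarrow> 'a \<Rightarrow> 'a" where
  "parent G r v = snd (hd (root_path G r v))"

section \<open>The family MPMRF\<close>

definition thinning :: "(nat \<Rightarrow> bool) \<Rightarrow> nat \<Rightarrow> nat" where
  "thinning I n = (\<Sum>i<n. of_bool (I i))"

text \<open>
  The pathwise recursion defining the counts: \<open>l\<close> is a realisation of the variables attached to the
  vertices, and \<open>I (e, i)\<close> a realisation of the \<open>i\<close>-th Bernoulli variable attached to the edge \<open>e\<close>.
\<close>

definition mpmrf_recursion ::
    "'a pair_pre_digraph \<Rightarrow> 'a \<Rightarrow> ('a \<Rightarrow> nat) \<Rightarrow> ('a set \<times> nat \<Rightarrow> bool) \<Rightarrow> ('a \<Rightarrow> nat) \<Rightarrow> bool" where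
  "mpmrf_recursion G r l I n \<longleftrightarrow>
     n r = l r \<and>
     (\<forall>v\<in>pverts G - {r}. n v = l v + thinning (\<lambda>i. I ({parent G r v, v}, i)) (n (parent G r v)))"

definition mpmrf_counts ::
    "'a pair_pre_digraph \<Rightarrow> 'a \<Rightarrow> ('a \<Rightarrow> nat) \<Rightarrow> ('a set \<times> nat \<Rightarrow> bool) \<Rightarrow> 'a \<Rightarrow> nat" where
  "mpmrf_counts G r l I = (THE n. n \<in> extensional (pverts G) \<and> mpmrf_recursion G r l I n)"

definition innovation_rate ::
    "'a pair_pre_digraph \<Rightarrow> 'a \<Rightarrow> real \<Rightarrow> ('a set \<Rightarrow> real) \<Rightarrow> 'a \<Rightarrow> real" where
  "innovation_rate G r lam \<alpha> v = (if v = r then lam else lam * (1 - \<alpha> {parent G r v, v}))"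

text \<open>The joint law of all the independent vertex and thinning variables.\<close>

definition mpmrf_source ::
    "'a pair_pre_digraph \<Rightarrow> 'a \<Rightarrow> real \<Rightarrow> ('a set \<Rightarrow> real) \<Rightarrow> (('a \<Rightarrow> nat) \<times> ('a set \<times> nat \<Rightarrow> bool)) measure"
  where
  "mpmrf_source G r lam \<alpha> =
     (\<Pi>\<^sub>M v\<in>pverts G. measure_pmf (poisson_pmf (innovation_rate G r lam \<alpha> v))) \<Otimes>\<^sub>M
     (\<Pi>\<^sub>M x\<in>uedges G \<times> UNIV. measure_pmf (bernoulli_pmf (\<alpha> (fst x))))"

definition mpmrf_law ::
    "'a pair_pre_digraph \<Rightarrow> 'a \<Rightarrow> real \<Rightarrow> ('a set \<Rightarrow> real) \<Rightarrow> ('a \<Rightarrow> nat) measure" where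
  "mpmrf_law G r lam \<alpha> =
     distr (mpmrf_source G r lam \<alpha>) (\<Pi>\<^sub>M v\<in>pverts G. count_space UNIV)
       (\<lambda>(l, I). mpmrf_counts G r l I)"

text \<open>
  The random vector \<open>N\<close> on the probability space \<open>\<Omega>\<close> is distributed as MPMRF with parameters
  \<open>lam\<close>, \<open>\<alpha>\<close> and \<open>G\<close>, for some choice of the root (the law is the same for every choice).
\<close>

definition is_MPMRF ::
    "'w measure \<Rightarrow> ('a \<Rightarrow> 'w \<Rightarrow> nat) \<Rightarrow> real \<Rightarrow> ('a set \<Rightarrow> real) \<Rightarrow> 'a pair_pre_digraph \<Rightarrow> bool" where
  "is_MPMRF \<Omega> N lam \<alpha> G \<longleftrightarrow>
     prob_space \<Omega> \<and>
     (\<forall>v\<in>pverts G. N v \<in> \<Omega> \<rightarrow>\<^sub>M count_space UNIV) \<and>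
     (\<exists>r\<in>pverts G. distr \<Omega> (\<Pi>\<^sub>M v\<in>pverts G. count_space UNIV) (\<lambda>\<omega>. \<lambda>v\<in>pverts G. N v \<omega>)
        = mpmrf_law G r lam \<alpha>)"

subsection \<open>Well-definedness of the counts\<close>

context pair_tree
begin

lemma apath_root_path:
  assumes "v \<in> pverts G" "r \<in> pverts G"
  shows "apath v (root_path G r v) r"
  unfolding root_path_def using unique_path[OF assms] by (rule theI')

lemma root_path_eqI:
  assumes "v \<in> pverts G" "r \<in> pverts G" "apath v p r"
  shows "root_path G r v = p"
  using unique_path[OF assms(1,2)] apath_root_path[OF assms(1,2)] assms(3) by blast

lemma root_path_parent:
  assumes v: "v \<in> pverts G" "v \<noteq> r" and r: "r \<in> pverts G"
  shows "(v, parent G r v) \<in> parcs G"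
    and "parent G r v \<in> pverts G"
    and "root_path G r v = (v, parent G r v) # root_path G r (parent G r v)"
proof -
  have p: "apath v (root_path G r v) r" using v(1) r by (rule apath_root_path)
  then obtain e q where eq: "root_path G r v = e # q"
    using v(2) by (cases "root_path G r v") (auto simp: apath_Nil_iff)
  from p have e: "e \<in> parcs G" "fst e = v" and q: "apath (snd e) q r"
    by (auto simp: eq apath_Cons_iff)
  have par: "parent G r v = snd e" by (simp add: parent_def eq)
  show arc: "(v, parent G r v) \<in> parcs G" using e by (auto simp: par)
  then show ver: "parent G r v \<in> pverts G" by (rule in_arcsD2)
  have "root_path G r (parent G r v) = q"
    using ver r q by (intro root_path_eqI) (simp_all add: par)
  then show "root_path G r v = (v, parent G r v) # root_path G r (parent G r v)"
    using e by (auto simp: eq par)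
qed

lemma mpmrf_recursion_ex1:
  assumes r: "r \<in> pverts G"
  shows "\<exists>!n. n \<in> extensional (pverts G) \<and> mpmrf_recursion G r l I n"
proof (rule ex_ex1I)
  define f where "f p = foldr (\<lambda>e m. l (fst e) + thinning (\<lambda>i. I ({snd e, fst e}, i)) m) p (l r)" for p
  define n where "n = restrict (\<lambda>v. f (root_path G r v)) (pverts G)"
  have "root_path G r r = []"
    using r by (intro root_path_eqI) (auto simp: apath_Nil_iff)
  then have "mpmrf_recursion G r l I n"
    using r root_path_parent by (auto simp: mpmrf_recursion_def n_def f_def)
  then show "\<exists>n. n \<in> extensional (pverts G) \<and> mpmrf_recursion G r l I n"
    by (intro exI[of _ n]) (simp add: n_def)
next
  fix n m
  assume n: "n \<in> extensional (pverts G) \<and> mpmrf_recursion G r l I n"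
    and m: "m \<in> extensional (pverts G) \<and> mpmrf_recursion G r l I m"
  have "n v = m v" if "v \<in> pverts G" for v
    using that
  proof (induction "length (root_path G r v)" arbitrary: v rule: less_induct)
    case less
    show ?case
    proof (cases "v = r")
      case True
      then show ?thesis using n m by (simp add: mpmrf_recursion_def)
    next
      case False
      note par = root_path_parent[OF less.prems False r]
      have "length (root_path G r (parent G r v)) < length (root_path G r v)"
        using arg_cong[OF par(3), of length] by simp
      from less.hyps[OF this par(2)] show ?thesis
        using n m less.prems False by (simp add: mpmrf_recursion_def)
    qed
  qed
  then show "n = m" using n m by (auto intro: extensionalityI)
qed

lemma mpmrf_counts:
  assumes "r \<in> pverts G"
  shows "mpmrf_counts G r l I \<in> extensional (pverts G)"
    and "mpmrf_recursion G r l I (mpmrf_counts G r l I)"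
  using theI'[OF mpmrf_recursion_ex1[OF assms]] by (simp_all add: mpmrf_counts_def)

lemma measurable_mpmrf_counts:
  assumes r: "r \<in> pverts G"
  shows "(\<lambda>(l, I). mpmrf_counts G r l I) \<in>
    mpmrf_source G r lam \<alpha> \<rightarrow>\<^sub>M (\<Pi>\<^sub>M v\<in>pverts G. count_space UNIV)"
proof -
  let ?S = "mpmrf_source G r lam \<alpha>"
  have L: "(\<lambda>\<omega>. fst \<omega> v) \<in> ?S \<rightarrow>\<^sub>M count_space UNIV" if "v \<in> pverts G" for v
    unfolding mpmrf_source_def using that
    by (intro measurable_compose[OF measurable_fst]
        measurable_compose[OF measurable_component_singleton]) auto
  have B: "(\<lambda>\<omega>. snd \<omega> (e, i)) \<in> ?S \<rightarrow>\<^sub>M count_space UNIV" if "e \<in> uedges G" for e i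
    unfolding mpmrf_source_def using that
    by (intro measurable_compose[OF measurable_snd]
        measurable_compose[OF measurable_component_singleton]) auto
  have "(\<lambda>\<omega>. mpmrf_counts G r (fst \<omega>) (snd \<omega>) v) \<in> ?S \<rightarrow>\<^sub>M count_space UNIV"
    if "v \<in> pverts G" for v
    using that
  proof (induction "length (root_path G r v)" arbitrary: v rule: less_induct)
    case less
    show ?case
    proof (cases "v = r")
      case True
      then show ?thesis using mpmrf_counts(2)[OF r] L[OF r] by (simp add: mpmrf_recursion_def)
    next
      case False
      note par = root_path_parent[OF less.prems False r]
      let ?p = "parent G r v"
      have "length (root_path G r ?p) < length (root_path G r v)"
        using arg_cong[OF par(3), of length] by simp
      note IH [measurable] = less.hyps[OF this par(2)]
      note [measurable] = L[OF less.prems]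
      have e: "{?p, v} \<in> uedges G"
        using par(1) unfolding uedges_def by (force simp: insert_commute)
      note [measurable] = B[OF e]
      have [measurable]: "(\<lambda>\<omega>. thinning (\<lambda>i. snd \<omega> ({?p, v}, i)) m) \<in> ?S \<rightarrow>\<^sub>M count_space UNIV" for m
        unfolding thinning_def by measurable
      have "(\<lambda>\<omega>. thinning (\<lambda>i. snd \<omega> ({?p, v}, i)) (mpmrf_counts G r (fst \<omega>) (snd \<omega>) ?p))
          \<in> ?S \<rightarrow>\<^sub>M count_space UNIV"
        by (rule measurable_compose_countable[OF _ IH]) measurable
      then have "(\<lambda>\<omega>. fst \<omega> v + thinning (\<lambda>i. snd \<omega> ({?p, v}, i)) (mpmrf_counts G r (fst \<omega>) (snd \<omega>) ?p))
          \<in> ?S \<rightarrow>\<^sub>M count_space UNIV"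
        by measurable
      then show ?thesis
        using mpmrf_counts(2)[OF r] less.prems False by (simp add: mpmrf_recursion_def)
    qed
  qed
  then show ?thesis
    unfolding case_prod_beta
    using mpmrf_counts(1)[OF r]
    by (intro measurable_PiM_single') (auto simp: PiE_def)
qed

end

section \<open>Supermodular order, covariance and TVaR contributions\<close>

text \<open>On pairs, \<open>inf\<close>, \<open>sup\<close> and \<open>\<le>\<close> are componentwise.\<close>

definition supermodular :: "('b::lattice \<Rightarrow> real) \<Rightarrow> bool" where
  "supermodular \<zeta> \<longleftrightarrow> (\<forall>x y. \<zeta> x + \<zeta> y \<le> \<zeta> (inf x y) + \<zeta> (sup x y))"

definition sm_le :: "'w measure \<Rightarrow> ('w \<Rightarrow> 'b::lattice) \<Rightarrow> 'u measure \<Rightarrow> ('u \<Rightarrow> 'b) \<Rightarrow> bool" where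
  "sm_le \<Omega> X \<Omega>' X' \<longleftrightarrow>
     (\<forall>\<zeta>. supermodular \<zeta> \<and> integrable \<Omega> (\<lambda>\<omega>. \<zeta> (X \<omega>)) \<and> integrable \<Omega>' (\<lambda>\<omega>. \<zeta> (X' \<omega>)) \<longrightarrow>
        (\<integral>\<omega>. \<zeta> (X \<omega>) \<partial>\<Omega>) \<le> (\<integral>\<omega>. \<zeta> (X' \<omega>) \<partial>\<Omega>'))"

definition covariance :: "'w measure \<Rightarrow> ('w \<Rightarrow> real) \<Rightarrow> ('w \<Rightarrow> real) \<Rightarrow> real" where
  "covariance \<Omega> X Y = (\<integral>\<omega>. (X \<omega> - (\<integral>\<omega>'. X \<omega>' \<partial>\<Omega>)) * (Y \<omega> - (\<integral>\<omega>'. Y \<omega>' \<partial>\<Omega>)) \<partial>\<Omega>)"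

definition nat_cdf :: "'w measure \<Rightarrow> ('w \<Rightarrow> nat) \<Rightarrow> nat \<Rightarrow> real" where
  "nat_cdf \<Omega> M x = \<P>(\<omega> in \<Omega>. M \<omega> \<le> x)"

definition nat_pmf :: "'w measure \<Rightarrow> ('w \<Rightarrow> nat) \<Rightarrow> nat \<Rightarrow> real" where
  "nat_pmf \<Omega> M x = \<P>(\<omega> in \<Omega>. M \<omega> = x)"

definition VaR :: "'w measure \<Rightarrow> real \<Rightarrow> ('w \<Rightarrow> nat) \<Rightarrow> nat" where
  "VaR \<Omega> \<kappa> M = Inf {x. nat_cdf \<Omega> M x \<ge> \<kappa>}"

definition tvar_contribution :: "'w measure \<Rightarrow> real \<Rightarrow> ('w \<Rightarrow> nat) \<Rightarrow> ('w \<Rightarrow> nat) \<Rightarrow> real" where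
  "tvar_contribution \<Omega> \<kappa> X M =
     1 / (1 - \<kappa>) *
       ((\<integral>\<omega>. real (X \<omega>) * of_bool (M \<omega> > VaR \<Omega> \<kappa> M) \<partial>\<Omega>) +
        (nat_cdf \<Omega> M (VaR \<Omega> \<kappa> M) - \<kappa>) / nat_pmf \<Omega> M (VaR \<Omega> \<kappa> M) *
          (\<integral>\<omega>. real (X \<omega>) * of_bool (M \<omega> = VaR \<Omega> \<kappa> M) \<partial>\<Omega>))"

end

theory Submission
  imports Defs
begin

text \<open>
  Each claim evaluates the supermodular order at particular test functions. Since \<open>(x, y) \<mapsto> x\<close> and
  its negative are both supermodular, the two counts have equal means. The function
  \<open>(x, y) \<mapsto> x * y\<close> is supermodular, which with the equal means gives the claim on
  covariances. More generally \<open>(x, y) \<mapsto> x * g y\<close> is supermodular for every increasing \<open>g\<close>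
  (\<open>supermodular_times_mono\<close>); \<open>g y = - of_bool (y \<le> k)\<close> gives the claim on the lower-tail expectations.

  For the TVaR contributions, let \<open>x\<close> be the Value-at-Risk of the aggregate. The weight
  \<open>(F x - \<kappa>) / p x\<close> on the atom at \<open>x\<close> lies in \<open>[0, 1]\<close> by minimality of \<open>x\<close>. The contribution is
  thus, up to \<open>1 / (1 - \<kappa>)\<close>, a convex combination of the expectations of the count over
  \<open>M > x\<close> and \<open>M \<ge> x\<close>. These are increasing in the order because means agree and lower-tail
  expectations are decreasing (\<open>tvar_contribution_mono\<close>).

  All the expectations have to exist, and for this it suffices that every count is square integrable
  (\<open>is_MPMRF_square_integrable\<close>). Thinning never increases a count, so along the recursion
  \<open>N v \<le> L v + N (parent v)\<close>, and finite second moments propagate from the Poisson variables \<open>L\<close>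
  down the tree.
\<close>

section \<open>Second moments of the counts\<close>

text \<open>Since \<open>n\<^sup>2 \<le> 4 ^ n\<close>, the second moment is dominated by an exponential series.\<close>

lemma integrable_poisson_square:
  assumes "0 < r"
  shows "integrable (measure_pmf (poisson_pmf r)) (\<lambda>n. (real n)\<^sup>2)"
proof -
  have bound: "norm ((r ^ n / fact n * exp (- r)) * (real n)\<^sup>2)
      \<le> inverse (fact n) * (4 * r) ^ n * exp (- r)" for n
  proof -
    have "real n ^ 2 \<le> (2 ^ n) ^ 2"
      using of_nat_less_two_power[of n, where 'a = real] by (intro power_mono) auto
    also have "\<dots> = 4 ^ n"
      by (simp add: power2_eq_square flip: power_mult_distrib)
    finally have "(r ^ n / fact n * exp (- r)) * (real n)\<^sup>2 \<le> (r ^ n / fact n * exp (- r)) * 4 ^ n"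
      using assms by (intro mult_left_mono) auto
    then show ?thesis
      using assms by (simp add: field_simps power_mult_distrib abs_mult)
  qed
  have "summable (\<lambda>n. norm ((r ^ n / fact n * exp (- r)) * (real n)\<^sup>2))"
    by (rule summable_comparison_test'[OF summable_mult2[OF summable_exp[of "4 * r"], of "exp (- r)"], of 0])
      (use bound in simp)
  then show ?thesis
    unfolding measure_pmf_eq_density
    by (subst integrable_real_density) (use assms in \<open>auto simp: integrable_count_space_nat_iff intro!: AE_I2\<close>)
qed

lemma thinning_le: "thinning I n \<le> n"
  using sum_bounded_above[of "{..<n}" "\<lambda>i. of_bool (I i) :: nat" 1] by (simp add: thinning_def)

lemma integrable_power2_dominated:
  fixes f g h :: "'w \<Rightarrow> real"
  assumes "integrable \<Omega> (\<lambda>\<omega>. (f \<omega>)\<^sup>2)" "integrable \<Omega> (\<lambda>\<omega>. (g \<omega>)\<^sup>2)"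
    and "h \<in> borel_measurable \<Omega>"
    and "\<And>\<omega>. 0 \<le> h \<omega>" "\<And>\<omega>. h \<omega> \<le> f \<omega> + g \<omega>"
  shows "integrable \<Omega> (\<lambda>\<omega>. (h \<omega>)\<^sup>2)"
proof (rule Bochner_Integration.integrable_bound)
  show "integrable \<Omega> (\<lambda>\<omega>. 2 * (f \<omega>)\<^sup>2 + 2 * (g \<omega>)\<^sup>2)" using assms(1,2) by simp
  show "(\<lambda>\<omega>. (h \<omega>)\<^sup>2) \<in> borel_measurable \<Omega>" using assms(3) by measurable
  show "AE \<omega> in \<Omega>. norm ((h \<omega>)\<^sup>2) \<le> norm (2 * (f \<omega>)\<^sup>2 + 2 * (g \<omega>)\<^sup>2)"
  proof (rule AE_I2)
    fix \<omega>
    have "(h \<omega>)\<^sup>2 \<le> (f \<omega> + g \<omega>)\<^sup>2" using assms(4,5) by (intro power_mono) auto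
    also have "\<dots> \<le> 2 * (f \<omega>)\<^sup>2 + 2 * (g \<omega>)\<^sup>2"
      using sum_squares_bound[of "f \<omega>" "g \<omega>"] by (simp add: power2_sum)
    finally show "norm ((h \<omega>)\<^sup>2) \<le> norm (2 * (f \<omega>)\<^sup>2 + 2 * (g \<omega>)\<^sup>2)" by simp
  qed
qed

lemma integrable_mult_of_squares:
  fixes f g :: "'w \<Rightarrow> real"
  assumes "integrable \<Omega> (\<lambda>\<omega>. (f \<omega>)\<^sup>2)" "integrable \<Omega> (\<lambda>\<omega>. (g \<omega>)\<^sup>2)"
    and "f \<in> borel_measurable \<Omega>" "g \<in> borel_measurable \<Omega>"
  shows "integrable \<Omega> (\<lambda>\<omega>. f \<omega> * g \<omega>)"
proof (rule Bochner_Integration.integrable_bound)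
  show "integrable \<Omega> (\<lambda>\<omega>. (f \<omega>)\<^sup>2 + (g \<omega>)\<^sup>2)" using assms(1,2) by simp
  show "(\<lambda>\<omega>. f \<omega> * g \<omega>) \<in> borel_measurable \<Omega>" using assms(3,4) by measurable
  show "AE \<omega> in \<Omega>. norm (f \<omega> * g \<omega>) \<le> norm ((f \<omega>)\<^sup>2 + (g \<omega>)\<^sup>2)"
  proof (rule AE_I2)
    fix \<omega>
    have "2 * (\<bar>f \<omega>\<bar> * \<bar>g \<omega>\<bar>) \<le> (f \<omega>)\<^sup>2 + (g \<omega>)\<^sup>2"
      using sum_squares_bound[of "\<bar>f \<omega>\<bar>" "\<bar>g \<omega>\<bar>"] by simp
    moreover have "0 \<le> \<bar>f \<omega>\<bar> * \<bar>g \<omega>\<bar>" by simp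
    ultimately have "\<bar>f \<omega>\<bar> * \<bar>g \<omega>\<bar> \<le> (f \<omega>)\<^sup>2 + (g \<omega>)\<^sup>2" by linarith
    then show "norm (f \<omega> * g \<omega>) \<le> norm ((f \<omega>)\<^sup>2 + (g \<omega>)\<^sup>2)" by (simp add: abs_mult)
  qed
qed

context pair_tree
begin

lemma parent_edge_in_uedges:
  assumes "v \<in> pverts G" "v \<noteq> r" "r \<in> pverts G"
  shows "{parent G r v, v} \<in> uedges G"
  using root_path_parent(1)[OF assms] unfolding uedges_def by (force simp: insert_commute)

lemma integrable_square_innovation:
  assumes lam: "0 < lam" and \<alpha>: "\<forall>e\<in>uedges G. \<alpha> e < 1"
    and r: "r \<in> pverts G" and v: "v \<in> pverts G"
  shows "integrable (mpmrf_source G r lam \<alpha>) (\<lambda>\<omega>. (real (fst \<omega> v))\<^sup>2)"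
proof -
  let ?P = "\<lambda>v. measure_pmf (poisson_pmf (innovation_rate G r lam \<alpha> v))"
  let ?L = "\<Pi>\<^sub>M v\<in>pverts G. ?P v"
  let ?B = "\<Pi>\<^sub>M x\<in>uedges G \<times> UNIV. measure_pmf (bernoulli_pmf (\<alpha> (fst x)))"
  have "0 < innovation_rate G r lam \<alpha> v"
    using lam \<alpha> parent_edge_in_uedges[OF v _ r] by (auto simp: innovation_rate_def)
  then have "integrable (?P v) (\<lambda>n. (real n)\<^sup>2)" by (rule integrable_poisson_square)
  moreover have "distr ?L (?P v) (\<lambda>l. l v) = ?P v"
    using v by (intro distr_PiM_component measure_pmf.prob_space_axioms)
  ultimately have "integrable (distr ?L (?P v) (\<lambda>l. l v)) (\<lambda>n. (real n)\<^sup>2)" by (simp only:)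
  then have comp: "integrable ?L (\<lambda>l. (real (l v))\<^sup>2)"
    by (rule integrable_distr[OF measurable_component_singleton[OF v]])
  have "distr (?L \<Otimes>\<^sub>M ?B) ?L fst = ?L"
    by (intro prob_space.distr_pair_fst prob_space_PiM measure_pmf.prob_space_axioms)
  from ssubst[where P = "\<lambda>m. integrable m (\<lambda>l. (real (l v))\<^sup>2)", OF this comp] show ?thesis
    unfolding mpmrf_source_def by (rule integrable_distr[OF measurable_fst])
qed

text \<open>
  Induction along the path to the root: each count is at most the sum of its own innovation and its
  parent's count.
\<close>

lemma integrable_square_mpmrf_counts:
  assumes lam: "0 < lam" and \<alpha>: "\<forall>e\<in>uedges G. \<alpha> e < 1"
    and r: "r \<in> pverts G" and v: "v \<in> pverts G"
  shows "integrable (mpmrf_source G r lam \<alpha>) (\<lambda>\<omega>. (real (mpmrf_counts G r (fst \<omega>) (snd \<omega>) v))\<^sup>2)"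
  using v
proof (induction "length (root_path G r v)" arbitrary: v rule: less_induct)
  case less
  show ?case
  proof (cases "v = r")
    case True
    then show ?thesis
      using mpmrf_counts(2)[OF r] integrable_square_innovation[OF lam \<alpha> r r]
      by (simp add: mpmrf_recursion_def)
  next
    case False
    note par = root_path_parent[OF less.prems False r]
    have "length (root_path G r (parent G r v)) < length (root_path G r v)"
      using arg_cong[OF par(3), of length] by simp
    note IH = less.hyps[OF this par(2)]
    have le: "mpmrf_counts G r l I v \<le> l v + mpmrf_counts G r l I (parent G r v)" for l I
      using mpmrf_counts(2)[OF r, of l I] less.prems False
      by (simp add: mpmrf_recursion_def thinning_le)
    have "(\<lambda>\<omega>. (case \<omega> of (l, I) \<Rightarrow> mpmrf_counts G r l I) v)
        \<in> mpmrf_source G r lam \<alpha> \<rightarrow>\<^sub>M count_space UNIV"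
      using less.prems
      by (intro measurable_compose[OF measurable_mpmrf_counts[OF r]
            measurable_component_singleton[of v "pverts G" "\<lambda>_. count_space UNIV"]])
    then have [measurable]: "(\<lambda>\<omega>. mpmrf_counts G r (fst \<omega>) (snd \<omega>) v)
        \<in> mpmrf_source G r lam \<alpha> \<rightarrow>\<^sub>M count_space UNIV"
      by (simp add: case_prod_beta)
    show ?thesis
    proof (rule integrable_power2_dominated[OF integrable_square_innovation[OF lam \<alpha> r less.prems] IH])
      show "(\<lambda>\<omega>. real (mpmrf_counts G r (fst \<omega>) (snd \<omega>) v))
          \<in> borel_measurable (mpmrf_source G r lam \<alpha>)"
        by measurable
      show "0 \<le> real (mpmrf_counts G r (fst \<omega>) (snd \<omega>) v)" for \<omega> by (rule of_nat_0_le_iff)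
      show "real (mpmrf_counts G r (fst \<omega>) (snd \<omega>) v)
          \<le> real (fst \<omega> v) + real (mpmrf_counts G r (fst \<omega>) (snd \<omega>) (parent G r v))" for \<omega>
        using le[of "fst \<omega>" "snd \<omega>"] by linarith
    qed
  qed
qed

lemma is_MPMRF_square_integrable:
  assumes lam: "0 < lam" and \<alpha>: "\<forall>e\<in>uedges G. \<alpha> e < 1"
    and N: "is_MPMRF \<Omega> N lam \<alpha> G" and v: "v \<in> pverts G"
  shows "integrable \<Omega> (\<lambda>\<omega>. (real (N v \<omega>))\<^sup>2)"
proof -
  let ?C = "\<Pi>\<^sub>M v\<in>pverts G. count_space (UNIV :: nat set)"
  obtain r where r: "r \<in> pverts G"
    and law: "distr \<Omega> ?C (\<lambda>\<omega>. \<lambda>v\<in>pverts G. N v \<omega>) = mpmrf_law G r lam \<alpha>"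
    and meas: "\<And>v. v \<in> pverts G \<Longrightarrow> N v \<in> \<Omega> \<rightarrow>\<^sub>M count_space UNIV"
    using N unfolding is_MPMRF_def by blast
  have vec: "(\<lambda>\<omega>. \<lambda>v\<in>pverts G. N v \<omega>) \<in> \<Omega> \<rightarrow>\<^sub>M ?C"
    using meas by (intro measurable_restrict)
  have "(\<lambda>n. n v) \<in> ?C \<rightarrow>\<^sub>M count_space UNIV"
    using v by (rule measurable_component_singleton)
  then have sq: "(\<lambda>n. (real (n v))\<^sup>2) \<in> borel_measurable ?C"
    by (rule measurable_compose) simp
  have "integrable (mpmrf_law G r lam \<alpha>) (\<lambda>n. (real (n v))\<^sup>2)"
    unfolding mpmrf_law_def integrable_distr_eq[OF measurable_mpmrf_counts[OF r] sq]
    using integrable_square_mpmrf_counts[OF lam \<alpha> r v] by (simp add: case_prod_beta)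
  then have "integrable \<Omega> (\<lambda>\<omega>. (real ((\<lambda>v\<in>pverts G. N v \<omega>) v))\<^sup>2)"
    unfolding law[symmetric] integrable_distr_eq[OF vec sq] .
  then show ?thesis using v by simp
qed

end

section \<open>Supermodular test functions\<close>

text \<open>
  Only incomparable arguments matter. For these the inequality says
  \<open>0 \<le> (x' - x) * (g y - g y')\<close> with \<open>x < x'\<close> and \<open>y' < y\<close>.
\<close>

lemma supermodular_times_mono:
  fixes g :: "real \<Rightarrow> real"
  assumes "mono g"
  shows "supermodular (\<lambda>(x, y). x * g y)"
proof -
  have *: "x * g y + x' * g y' \<le> inf x x' * g (inf y y') + sup x x' * g (sup y y')" for x x' y y' :: real
  proof -
    have cross: "b * g d + a * g c \<le> b * g c + a * g d" if "a \<le> b" "d \<le> c" for a b c d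
    proof -
      have "0 \<le> (b - a) * (g c - g d)" using that monoD[OF assms] by (intro mult_nonneg_nonneg) auto
      then show ?thesis by (simp add: algebra_simps)
    qed
    show ?thesis
      using cross[of x x' y' y] cross[of x' x y y']
      by (cases "x \<le> x'"; cases "y \<le> y'") (auto simp: inf_min sup_max min_def max_def)
  qed
  then show ?thesis by (auto simp: supermodular_def)
qed

lemma sm_le_expectation_times_mono:
  fixes X Y M :: "'w \<Rightarrow> real"
  assumes "sm_le \<Omega> (\<lambda>\<omega>. (X \<omega>, M \<omega>)) \<Omega> (\<lambda>\<omega>. (Y \<omega>, M \<omega>))" "mono g"
    and "integrable \<Omega> (\<lambda>\<omega>. X \<omega> * g (M \<omega>))" "integrable \<Omega> (\<lambda>\<omega>. Y \<omega> * g (M \<omega>))"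
  shows "(\<integral>\<omega>. X \<omega> * g (M \<omega>) \<partial>\<Omega>) \<le> (\<integral>\<omega>. Y \<omega> * g (M \<omega>) \<partial>\<Omega>)"
  using assms(1)[unfolded sm_le_def, rule_format, of "\<lambda>(x, y). x * g y"]
    supermodular_times_mono[OF assms(2)] assms(3,4) by simp

text \<open>The constant functions \<open>1\<close> and \<open>-1\<close> are both increasing.\<close>

lemma sm_le_imp_expectation_eq:
  fixes X Y M :: "'w \<Rightarrow> real"
  assumes "sm_le \<Omega> (\<lambda>\<omega>. (X \<omega>, M \<omega>)) \<Omega> (\<lambda>\<omega>. (Y \<omega>, M \<omega>))"
    and "integrable \<Omega> X" "integrable \<Omega> Y"
  shows "(\<integral>\<omega>. X \<omega> \<partial>\<Omega>) = (\<integral>\<omega>. Y \<omega> \<partial>\<Omega>)"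
  using sm_le_expectation_times_mono[OF assms(1), of "\<lambda>_. 1"]
    sm_le_expectation_times_mono[OF assms(1), of "\<lambda>_. - 1"] assms(2,3)
  by (simp add: mono_def)

section \<open>Covariances and TVaR contributions\<close>

lemma (in prob_space) covariance_eq:
  assumes "integrable M X" "integrable M Y" "integrable M (\<lambda>\<omega>. X \<omega> * Y \<omega>)"
  shows "covariance M X Y = expectation (\<lambda>\<omega>. X \<omega> * Y \<omega>) - expectation X * expectation Y"
  using assms by (simp add: covariance_def algebra_simps prob_space)

text \<open>
  The infimum defining the Value-at-Risk is attained since the cdf tends to \<open>1 > \<kappa>\<close>. By its
  minimality, the cdf just below it is smaller than \<open>\<kappa>\<close>.
\<close>

lemma (in prob_space) VaR_atom:
  assumes X [measurable]: "X \<in> M \<rightarrow>\<^sub>M count_space UNIV" and "0 \<le> \<kappa>" "\<kappa> < 1"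
  shows "\<kappa> \<le> nat_cdf M X (VaR M \<kappa> X)"
    and "nat_cdf M X (VaR M \<kappa> X) - \<kappa> \<le> nat_pmf M X (VaR M \<kappa> X)"
proof -
  let ?F = "nat_cdf M X" and ?x = "VaR M \<kappa> X"
  have "(\<lambda>n. prob {\<omega> \<in> space M. X \<omega> \<le> n}) \<longlonglongrightarrow> prob (\<Union>n. {\<omega> \<in> space M. X \<omega> \<le> n})"
    by (rule finite_Lim_measure_incseq) (auto simp: incseq_def)
  moreover have "(\<Union>n. {\<omega> \<in> space M. X \<omega> \<le> n}) = space M" by auto
  ultimately have "?F \<longlonglongrightarrow> 1" by (simp add: nat_cdf_def[abs_def] prob_space)
  then have "eventually (\<lambda>n. \<kappa> < ?F n) sequentially" using assms(3) by (rule order_tendstoD(1))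
  then obtain n where "\<kappa> \<le> ?F n" by (auto simp: eventually_sequentially intro: less_imp_le)
  then have "?x \<in> {x. \<kappa> \<le> ?F x}" unfolding VaR_def by (intro Inf_nat_def1) auto
  then show "\<kappa> \<le> ?F ?x" by simp
  show "?F ?x - \<kappa> \<le> nat_pmf M X ?x"
  proof (cases ?x)
    case 0
    then show ?thesis using assms(2) by (simp add: nat_cdf_def nat_pmf_def)
  next
    case (Suc y)
    have "y \<notin> {x. \<kappa> \<le> ?F x}"
      using Suc by (intro not_less_Least) (metis Inf_nat_def VaR_def lessI)
    moreover have "{\<omega> \<in> space M. X \<omega> \<le> Suc y} = {\<omega> \<in> space M. X \<omega> \<le> y} \<union> {\<omega> \<in> space M. X \<omega> = Suc y}"
      by auto
    then have "?F (Suc y) = ?F y + nat_pmf M X (Suc y)"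
      unfolding nat_cdf_def nat_pmf_def by (simp add: finite_measure_Union disjoint_iff)
    ultimately show ?thesis using Suc by simp
  qed
qed

text \<open>
  A fraction \<open>c\<close> of the atom at the Value-at-Risk \<open>x\<close> counts towards the tail. Writing the atom as
  the difference of the tails \<open>S \<ge> x\<close> and \<open>S > x\<close> turns the contribution, up to \<open>1 / (1 - \<kappa>)\<close>, into
  \<open>1 - c\<close> times the strict tail expectation plus \<open>c\<close> times the weak one, both with
  nonnegative weights.
\<close>

lemma (in prob_space) tvar_contribution_mono:
  fixes X Y S :: "'a \<Rightarrow> nat"
  assumes [measurable]: "S \<in> M \<rightarrow>\<^sub>M count_space UNIV"
    and X: "integrable M (\<lambda>\<omega>. real (X \<omega>))" and Y: "integrable M (\<lambda>\<omega>. real (Y \<omega>))"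
    and mean: "expectation (\<lambda>\<omega>. real (X \<omega>)) = expectation (\<lambda>\<omega>. real (Y \<omega>))"
    and lower: "\<And>k. expectation (\<lambda>\<omega>. real (Y \<omega>) * of_bool (S \<omega> \<le> k))
      \<le> expectation (\<lambda>\<omega>. real (X \<omega>) * of_bool (S \<omega> \<le> k))"
    and \<kappa>: "0 \<le> \<kappa>" "\<kappa> < 1"
  shows "tvar_contribution M \<kappa> X S \<le> tvar_contribution M \<kappa> Y S"
proof -
  define x where "x = VaR M \<kappa> S"
  define c where "c = (nat_cdf M S x - \<kappa>) / nat_pmf M S x"
  \<comment> \<open>If the atom has probability 0, the quotient is 0 by convention and the bounds still hold.\<close>
  have c: "0 \<le> c" "c \<le> 1"
    using VaR_atom[OF assms(1) \<kappa>]
    by (auto simp: c_def x_def nat_pmf_def divide_le_eq_1 less_le intro!: divide_nonneg_nonneg)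
  have int: "integrable M (\<lambda>\<omega>. real (Z \<omega>) * of_bool (P (S \<omega>)))"
    if "integrable M (\<lambda>\<omega>. real (Z \<omega>))" for Z P
    using that by (rule Bochner_Integration.integrable_bound)
      (use that borel_measurable_integrable[OF that] in auto)
  have split: "expectation (\<lambda>\<omega>. real (Z \<omega>) * of_bool (k < S \<omega>))
      = expectation (\<lambda>\<omega>. real (Z \<omega>)) - expectation (\<lambda>\<omega>. real (Z \<omega>) * of_bool (S \<omega> \<le> k))"
    if "integrable M (\<lambda>\<omega>. real (Z \<omega>))" for Z k
    unfolding Bochner_Integration.integral_diff[OF that int[OF that, of "\<lambda>s. s \<le> k"], symmetric]
    by (rule Bochner_Integration.integral_cong) auto
  have upper: "expectation (\<lambda>\<omega>. real (X \<omega>) * of_bool (k < S \<omega>))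
      \<le> expectation (\<lambda>\<omega>. real (Y \<omega>) * of_bool (k < S \<omega>))" for k
    using lower[of k] by (simp add: split X Y mean)
  have upper_eq: "expectation (\<lambda>\<omega>. real (X \<omega>) * of_bool (x \<le> S \<omega>))
      \<le> expectation (\<lambda>\<omega>. real (Y \<omega>) * of_bool (x \<le> S \<omega>))"
    by (cases x) (use mean upper in \<open>auto simp: Suc_le_eq\<close>)
  have "tvar_contribution M \<kappa> Z S = 1 / (1 - \<kappa>) *
      ((1 - c) * expectation (\<lambda>\<omega>. real (Z \<omega>) * of_bool (x < S \<omega>))
        + c * expectation (\<lambda>\<omega>. real (Z \<omega>) * of_bool (x \<le> S \<omega>)))"
    if "integrable M (\<lambda>\<omega>. real (Z \<omega>))" for Z
  proof -
    have "expectation (\<lambda>\<omega>. real (Z \<omega>) * of_bool (x \<le> S \<omega>))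
        = expectation (\<lambda>\<omega>. real (Z \<omega>) * of_bool (x < S \<omega>))
          + expectation (\<lambda>\<omega>. real (Z \<omega>) * of_bool (S \<omega> = x))"
      unfolding Bochner_Integration.integral_add
        [OF int[OF that, of "\<lambda>s. x < s"] int[OF that, of "\<lambda>s. s = x"], symmetric]
      by (rule Bochner_Integration.integral_cong) auto
    then show ?thesis
      by (simp add: tvar_contribution_def c_def x_def[symmetric] algebra_simps)
  qed
  then show ?thesis
    using X Y c \<kappa> upper[of x] upper_eq
    by (simp add: divide_right_mono add_mono mult_left_mono)
qed

section \<open>Ordering of the contributions\<close>

theorem proposition1:
  fixes G :: "'a pair_pre_digraph"
    and \<Omega> :: "'w measure"
    and N :: "'a \<Rightarrow> 'w \<Rightarrow> nat"
    and M :: "'w \<Rightarrow> nat"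
    and lam :: real
    and \<alpha> :: "'a set \<Rightarrow> real"
    and v w :: 'a
  assumes "pair_tree G"
    and "lam > 0"
    and "\<forall>e\<in>uedges G. 0 < \<alpha> e \<and> \<alpha> e < 1"
    and "is_MPMRF \<Omega> N lam \<alpha> G"
    and "M = (\<lambda>\<omega>. \<Sum>j\<in>pverts G. N j \<omega>)"
    and "v \<in> pverts G" and "w \<in> pverts G"
    and "sm_le \<Omega> (\<lambda>\<omega>. (real (N v \<omega>), real (M \<omega>))) \<Omega> (\<lambda>\<omega>. (real (N w \<omega>), real (M \<omega>)))"
  shows "covariance \<Omega> (\<lambda>\<omega>. real (N v \<omega>)) (\<lambda>\<omega>. real (M \<omega>))
           \<le> covariance \<Omega> (\<lambda>\<omega>. real (N w \<omega>)) (\<lambda>\<omega>. real (M \<omega>)) \<and>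
         (\<forall>k::nat. (\<integral>\<omega>. real (N v \<omega>) * of_bool (M \<omega> \<le> k) \<partial>\<Omega>)
           \<ge> (\<integral>\<omega>. real (N w \<omega>) * of_bool (M \<omega> \<le> k) \<partial>\<Omega>)) \<and>
         (\<forall>\<kappa>\<in>{0..<1::real}. tvar_contribution \<Omega> \<kappa> (N v) M \<le> tvar_contribution \<Omega> \<kappa> (N w) M)"
proof -
  interpret pair_tree G by (rule assms(1))
  interpret prob_space \<Omega> using assms(4) by (simp add: is_MPMRF_def)
  have meas: "N j \<in> \<Omega> \<rightarrow>\<^sub>M count_space UNIV" if "j \<in> pverts G" for j
    using assms(4) that by (simp add: is_MPMRF_def)
  have real_meas: "(\<lambda>\<omega>. real (N j \<omega>)) \<in> borel_measurable \<Omega>" if "j \<in> pverts G" for j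
    using meas[OF that] by measurable
  have M [measurable]: "M \<in> \<Omega> \<rightarrow>\<^sub>M count_space UNIV"
    unfolding assms(5) using meas by measurable
  have sq: "integrable \<Omega> (\<lambda>\<omega>. (real (N j \<omega>))\<^sup>2)" if "j \<in> pverts G" for j
    using assms(2,3) by (intro is_MPMRF_square_integrable[OF _ _ assms(4) that]) auto
  have int: "integrable \<Omega> (\<lambda>\<omega>. real (N j \<omega>))" if "j \<in> pverts G" for j
    using real_meas[OF that] sq[OF that] by (rule square_integrable_imp_integrable)
  have M_eq: "real (M \<omega>) = (\<Sum>j\<in>pverts G. real (N j \<omega>))" for \<omega> by (simp add: assms(5))
  have intM: "integrable \<Omega> (\<lambda>\<omega>. real (M \<omega>))"
    unfolding M_eq using int by simp
  have intNM: "integrable \<Omega> (\<lambda>\<omega>. real (N j \<omega>) * real (M \<omega>))" if "j \<in> pverts G" for j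
    unfolding M_eq sum_distrib_left
    using that by (intro Bochner_Integration.integrable_sum integrable_mult_of_squares sq real_meas)
  have intlow: "integrable \<Omega> (\<lambda>\<omega>. real (N j \<omega>) * - of_bool (real (M \<omega>) \<le> real k))"
    if "j \<in> pverts G" for j k
    using int[OF that] by (rule Bochner_Integration.integrable_bound)
      (use real_meas[OF that] in auto)
  note v = assms(6) and w = assms(7) and sm = assms(8)
  have mean: "expectation (\<lambda>\<omega>. real (N v \<omega>)) = expectation (\<lambda>\<omega>. real (N w \<omega>))"
    using sm int[OF v] int[OF w] by (rule sm_le_imp_expectation_eq)
  have "expectation (\<lambda>\<omega>. real (N v \<omega>) * real (M \<omega>)) \<le> expectation (\<lambda>\<omega>. real (N w \<omega>) * real (M \<omega>))"
    by (rule sm_le_expectation_times_mono[OF sm, of "\<lambda>y. y"])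
      (use intNM v w in \<open>auto simp: mono_def\<close>)
  then have cov: "covariance \<Omega> (\<lambda>\<omega>. real (N v \<omega>)) (\<lambda>\<omega>. real (M \<omega>))
      \<le> covariance \<Omega> (\<lambda>\<omega>. real (N w \<omega>)) (\<lambda>\<omega>. real (M \<omega>))"
    by (simp add: covariance_eq int v w intM intNM mean)
  have low: "expectation (\<lambda>\<omega>. real (N w \<omega>) * of_bool (M \<omega> \<le> k))
      \<le> expectation (\<lambda>\<omega>. real (N v \<omega>) * of_bool (M \<omega> \<le> k))" for k
  proof -
    have "mono (\<lambda>y. - of_bool (y \<le> real k) :: real)" by (auto simp: mono_def)
    from sm_le_expectation_times_mono[OF sm this intlow[OF v] intlow[OF w]]
    show ?thesis by simp
  qed
  have "tvar_contribution \<Omega> \<kappa> (N v) M \<le> tvar_contribution \<Omega> \<kappa> (N w) M"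
    if "\<kappa> \<in> {0..<1}" for \<kappa>
    using that low by (intro tvar_contribution_mono M int v w mean) auto
  with cov low show ?thesis by blast
qed

end
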